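(* Let $\Phi_h$ be a symplectic integrator of order at least $1$, applied to a Hamiltonian system $\dot y=f(y)=J^{-1}\nabla H(y)$ on $\mathbb{R}^{2d}$ with a smooth Hamiltonian $H:\mathbb{R}^{2d}\to\mathbb{R}$. Then the inverse modified equation $$\dot{\tilde y}=f_h(\tilde y)=f_1(\tilde y)+hf_2(\tilde y)+h^2f_3(\tilde y)+\cdots$$ of this system with respect to $\Phi_h$ is also a Hamiltonian system. More precisely, there exist smooth functions $H_j:\mathbb{R}^{2d}\to\mathbb{R}$, $j=1,2,3,\dots$, such that $$f_j(y)=J^{-1}\nabla H_j(y)\qquad\text{for all } j\ge 1 \text{ and } y\in\mathbb{R}^{2d}.$$
   Context: Notation. $J=\begin{pmatrix}0&I_d\\-I_d&0\end{pmatrix}$, where $I_d$ is the $d\times d$ identity matrix. A differentiable map $g:U\to\mathbb{R}^{2d}$ on an open set $U\subseteq\mathbb{R}^{2d}$ is called symplectic if $g'(y)^TJg'(y)=J$ for all $y\in U$, where $g'(y)$ is the Jacobian. A Hamiltonian system is one of the form $\dot y=J^{-1}\nabla H(y)$. All statements about expansions are at the level of formal power series in the step size $h$ (no convergence is claimed). Exact flow. For a smooth vector field $f$ on $\mathbb{R}^{2d}$, $\phi_h(f,y)$ is the time-$h$ flow of $\dot y=f(y)$ started at $y$. It is identified with its Taylor expansion $$\phi_h(f,y)=y+hf(y)+\tfrac{h^2}{2}f'(y)f(y)+\tfrac{h^3}{6}\big(f''(f,f)(y)+f'f'f(y)\big)+\cdots .$$ Integrator. A (one-step) numerical integrator $\Phi_h$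 assigns to each smooth vector field $g$ a one-step map $y\mapsto\Phi_h(g,y)$ with an expansion $$\Phi_h(g,y)=y+h\,d_1(g,y)+h^2d_2(g,y)+h^3d_3(g,y)+\cdots.$$ Here each $d_j(g,\cdot)$ is a given expression, the same for all $g$, composed of $g$ and its derivatives (a polynomial expression in the components of $g$ and their partial derivatives, evaluated at $y$). Hence a formal power series $g=\sum_{k\ge1}h^{k-1}g_k$ of smooth vector fields may be substituted for $g$ and the result re-expanded in powers of $h$. The integrator has order at least $1$ if $\Phi_h(g,y)=\phi_h(g,y)+O(h^2)$ for all smooth $g$, i.e. $d_1(g,y)=g(y)$. Symplectic integrator. $\Phi_h$ is called symplectic if the one-step map $y\mapsto\Phi_h(g,y)$ is symplectic whenever the integrator is applied to a smooth Hamiltonian system $\dot y=g(y)=J^{-1}\nabla K(y)$. This includes the case where, for fixed $h$, the Hamiltonian $K$ is a polynomial in $h$ with smooth coefficient functions. Inverse modified equation. Given $f$ and $\Phi_h$, the inverse modified equation is $\dot{\tilde y}=f_h(\tilde y)$, where $f_h=f_1+hf_2+h^2f_3+\cdots$ is the formal power series whose $h$-independent smooth coefficients $f_j$ are determined recursively by requiring $$\Phi_h(f_h,y)=\phi_h(f,y)$$ as formal power series in $h$, comparing like powers of $h$. *)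

theory Defs
  imports
    "HOL-Analysis.Analysis"
    "HOL-Computational_Algebra.Formal_Power_Series"
    "HOL-Library.Landau_Symbols"
begin

section \<open>Smooth functions, gradients, Hamiltonian vector fields\<close>

primrec partials ::
  "'n list \<Rightarrow> (real ^ 'n::finite \<Rightarrow> 'b::real_normed_vector) \<Rightarrow> real ^ 'n \<Rightarrow> 'b" where
  "partials [] f = f"
| "partials (i # \<alpha>) f = (\<lambda>y. frechet_derivative (partials \<alpha> f) (at y) (axis i 1))"

text \<open>
  \<open>C\<^sup>\<infinity>\<close> on the whole space: every iterated partial derivative exists and is (totally)
  differentiable everywhere, hence also continuous.
\<close>

definition smooth :: "(real ^ 'n::finite \<Rightarrow> 'b::real_normed_vector) \<Rightarrow> bool" where
  "smooth f \<longleftrightarrow> (\<forall>\<alpha> y. partials \<alpha> f differentiable (at y))"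

definition grad :: "(real ^ 'n::finite \<Rightarrow> real) \<Rightarrow> real ^ 'n \<Rightarrow> real ^ 'n" where
  "grad K y = (\<chi> i. partials [i] K y)"

text \<open>
  Phase space is \<open>real ^ ('d + 'd)\<close>; indices \<open>Inl i\<close> are the first \<open>d\<close> coordinates and
  \<open>Inr i\<close> the last \<open>d\<close>.
\<close>

definition J_mat :: "real ^ ('d::finite + 'd) ^ ('d + 'd)" where
  "J_mat = (\<chi> a b. case (a, b) of
      (Inl i, Inr j) \<Rightarrow> if i = j then 1 else 0
    | (Inr i, Inl j) \<Rightarrow> if i = j then - 1 else 0
    | _ \<Rightarrow> 0)"

definition ham_field ::
  "(real ^ ('d::finite + 'd) \<Rightarrow> real) \<Rightarrow> real ^ ('d + 'd) \<Rightarrow> real ^ ('d + 'd)" where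
  "ham_field K y = matrix_inv J_mat *v grad K y"

definition symplectic_on ::
  "(real ^ ('d::finite + 'd)) set \<Rightarrow> (real ^ ('d + 'd) \<Rightarrow> real ^ ('d + 'd)) \<Rightarrow> bool" where
  "symplectic_on U g \<longleftrightarrow> open U \<and>
     (\<forall>y\<in>U. g differentiable (at y) \<and>
       transpose (jacobian g (at y)) ** J_mat ** jacobian g (at y) = J_mat)"


section \<open>Differential polynomials and their formal re-expansion\<close>

text \<open>
  A polynomial expression in the components of an unspecified vector field and their partial
  derivatives: \<open>Jet i \<alpha>\<close> stands for the iterated partial derivative \<open>\<alpha>\<close> of the
  \<open>i\<close>-th component.
\<close>

datatype 'n dpoly =
    Const real
  | Jet 'n "'n list"
  | Add "'n dpoly" "'n dpoly"
  | Mult "'n dpoly" "'n dpoly"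

primrec dpoly_eval ::
  "(real \<Rightarrow> 'a::comm_ring_1) \<Rightarrow> ('n \<Rightarrow> 'n list \<Rightarrow> 'a) \<Rightarrow> 'n dpoly \<Rightarrow> 'a" where
  "dpoly_eval c u (Const r) = c r"
| "dpoly_eval c u (Jet i \<alpha>) = u i \<alpha>"
| "dpoly_eval c u (Add p q) = dpoly_eval c u p + dpoly_eval c u q"
| "dpoly_eval c u (Mult p q) = dpoly_eval c u p * dpoly_eval c u q"

definition dpoly_at ::
  "'n::finite dpoly \<Rightarrow> (real ^ 'n \<Rightarrow> real ^ 'n) \<Rightarrow> real ^ 'n \<Rightarrow> real" where
  "dpoly_at p g y = dpoly_eval (\<lambda>r. r) (\<lambda>i \<alpha>. partials \<alpha> (\<lambda>z. g z $ i) y) p"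

text \<open>
  The same expression for the formal series \<open>\<Sum>\<^sub>k\<^sub>\<ge>\<^sub>1 h\<^sup>k\<^sup>-\<^sup>1 G k\<close>, as a formal
  power series in \<open>h\<close>. Here and below the entry \<open>G 0\<close> is never used.
\<close>

definition dpoly_series ::
  "'n::finite dpoly \<Rightarrow> (nat \<Rightarrow> real ^ 'n \<Rightarrow> real ^ 'n) \<Rightarrow> real ^ 'n \<Rightarrow> real fps" where
  "dpoly_series p G y =
     dpoly_eval fps_const (\<lambda>i \<alpha>. Abs_fps (\<lambda>k. partials \<alpha> (\<lambda>z. G (Suc k) z $ i) y)) p"

text \<open>
  The coefficient of \<open>h\<^sup>n\<close> in \<open>y + \<Sum>\<^sub>j\<^sub>\<ge>\<^sub>1 h\<^sup>j d\<^sub>j(G, y)\<close>, with the formal series \<open>G\<close>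
  substituted and everything re-expanded; \<open>d j i\<close> is the \<open>i\<close>-th component of \<open>d\<^sub>j\<close>.
  If \<open>G k = 0\<close> for all \<open>k \<ge> 2\<close>, then for \<open>n \<ge> 1\<close> this is just \<open>d\<^sub>n(G 1, y)\<close>.
\<close>

definition step_coeff ::
  "(nat \<Rightarrow> 'n \<Rightarrow> 'n::finite dpoly) \<Rightarrow> (nat \<Rightarrow> real ^ 'n \<Rightarrow> real ^ 'n) \<Rightarrow> nat
     \<Rightarrow> real ^ 'n \<Rightarrow> real ^ 'n" where
  "step_coeff d G n y =
     (if n = 0 then y else 0) +
     (\<chi> i. \<Sum>j = 1..n. fps_nth (dpoly_series (d j i) G y) (n - j))"


section \<open>Integrators\<close>

text \<open>Asymptotic expansion \<open>u h \<sim> \<Sum>\<^sub>j h\<^sup>j c j\<close> for step sizes \<open>h \<rightarrow> 0\<close>, \<open>h > 0\<close>.\<close>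

definition expands :: "(real \<Rightarrow> 'a::real_normed_vector) \<Rightarrow> (nat \<Rightarrow> 'a) \<Rightarrow> bool" where
  "expands u c \<longleftrightarrow>
     (\<forall>N. (\<lambda>h. norm (u h - (\<Sum>j\<le>N. h ^ j *\<^sub>R c j))) \<in> O[at_right 0](\<lambda>h. h ^ Suc N))"

text \<open>
  \<open>\<Phi> h g\<close> is the one-step map for the vector field \<open>g\<close> and the step size \<open>h\<close>. As for implicit
  methods, it need only be meaningful on a set \<open>D h g\<close>, which eventually contains any given point
  as \<open>h \<rightarrow> 0\<close>. The expansion with coefficient expressions \<open>d\<close> is required to survive the two
  operations that a formal series in \<open>h\<close> is subjected to: substituting a vector field that is
  itself a polynomial in \<open>h\<close> (a fixed vector field being the case \<open>r = 1\<close>), and differentiating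
  termwise with respect to \<open>y\<close>.
\<close>

definition integrator ::
  "(real \<Rightarrow> (real ^ 'n \<Rightarrow> real ^ 'n) \<Rightarrow> (real ^ 'n) set) \<Rightarrow>
   (real \<Rightarrow> (real ^ 'n \<Rightarrow> real ^ 'n) \<Rightarrow> real ^ 'n \<Rightarrow> real ^ 'n) \<Rightarrow>
   (nat \<Rightarrow> 'n \<Rightarrow> 'n::finite dpoly) \<Rightarrow> bool" where
  "integrator D \<Phi> d \<longleftrightarrow>
     (\<forall>G r. (\<forall>k\<ge>1. smooth (G k)) \<and> (\<forall>k>r. G k = (\<lambda>_. 0)) \<longrightarrow>
       (let g = (\<lambda>h z. \<Sum>k = 1..r. h ^ (k - 1) *\<^sub>R G k z) in
        \<forall>y. (\<forall>\<^sub>F h in at_right 0. y \<in> D h (g h) \<and> \<Phi> h (g h) differentiable (at y)) \<and>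
            expands (\<lambda>h. \<Phi> h (g h) y) (\<lambda>n. step_coeff d G n y) \<and>
            expands (\<lambda>h. jacobian (\<Phi> h (g h)) (at y))
                    (\<lambda>n. jacobian (step_coeff d G n) (at y))))"

definition order_at_least_1 :: "(nat \<Rightarrow> 'n \<Rightarrow> 'n::finite dpoly) \<Rightarrow> bool" where
  "order_at_least_1 d \<longleftrightarrow> (\<forall>g. smooth g \<longrightarrow> (\<forall>y i. dpoly_at (d 1 i) g y = g y $ i))"

text \<open>
  Since \<open>K\<close> is arbitrary for each fixed \<open>h\<close>, Hamiltonians that are polynomials in \<open>h\<close> with smooth
  coefficient functions are included.
\<close>

definition symplectic_integrator ::
  "(real \<Rightarrow> (real ^ ('d + 'd) \<Rightarrow> real ^ ('d + 'd)) \<Rightarrow> (real ^ ('d + 'd)) set) \<Rightarrow>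
   (real \<Rightarrow> (real ^ ('d + 'd) \<Rightarrow> real ^ ('d + 'd)) \<Rightarrow>
      real ^ ('d + 'd) \<Rightarrow> real ^ ('d::finite + 'd)) \<Rightarrow> bool" where
  "symplectic_integrator D \<Phi> \<longleftrightarrow>
     (\<forall>h>0. \<forall>K. smooth K \<longrightarrow> symplectic_on (D h (ham_field K)) (\<Phi> h (ham_field K)))"


section \<open>Exact flow and inverse modified equation\<close>

definition local_flow ::
  "(real ^ 'n::finite \<Rightarrow> real ^ 'n) \<Rightarrow> (real \<Rightarrow> real ^ 'n \<Rightarrow> real ^ 'n) \<Rightarrow> bool" where
  "local_flow f \<phi> \<longleftrightarrow>
     (\<forall>y. \<phi> 0 y = y \<and>
       (\<exists>\<epsilon>>0. \<forall>t\<in>{-\<epsilon><..<\<epsilon>}. ((\<lambda>s. \<phi> s y) has_vector_derivative f (\<phi> t y)) (at t)))"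

definition flow_coeff ::
  "(real \<Rightarrow> real ^ 'n::finite \<Rightarrow> real ^ 'n) \<Rightarrow> nat \<Rightarrow> real ^ 'n \<Rightarrow> real ^ 'n" where
  "flow_coeff \<phi> n y =
     (1 / fact n) *\<^sub>R ((\<lambda>x t. vector_derivative x (at t)) ^^ n) (\<lambda>t. \<phi> t y) 0"

text \<open>
  \<open>F j\<close> is the coefficient \<open>f\<^sub>j\<close>, \<open>j \<ge> 1\<close>, of the inverse modified equation for the exact
  flow \<open>\<phi>\<close> and the integrator with coefficient expressions \<open>d\<close>.
\<close>

definition inverse_modified ::
  "(nat \<Rightarrow> 'n \<Rightarrow> 'n::finite dpoly) \<Rightarrow> (real \<Rightarrow> real ^ 'n \<Rightarrow> real ^ 'n) \<Rightarrow>
   (nat \<Rightarrow> real ^ 'n \<Rightarrow> real ^ 'n) \<Rightarrow> bool" where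
  "inverse_modified d \<phi> F \<longleftrightarrow>
     (\<forall>j\<ge>1. smooth (F j)) \<and> (\<forall>n y. step_coeff d F n y = flow_coeff \<phi> n y)"

end

theory Submission
  imports Defs "HOL-Computational_Algebra.Polynomial_FPS"
begin

text \<open>
  Induction on \<open>j = r + 1\<close>. If \<open>f\<^sub>1, \<dots>, f\<^sub>r\<close> are Hamiltonian, then so is the truncation
  \<open>f\<^sub>1 + \<dots> + h\<^sup>r\<^sup>-\<^sup>1 f\<^sub>r\<close> for each fixed \<open>h\<close>, hence the integrator applied to it is symplectic. The Jacobians
  of its expansion coefficients thus satisfy \<open>\<Sum>\<^sub>a A\<^sub>a\<^sup>T J A\<^sub>n\<^sub>-\<^sub>a = 0\<close> for \<open>n \<ge> 1\<close>, and so do those of the Taylor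
  coefficients of the exact flow. Both expansions agree up to \<open>h\<^sup>r\<close>, and because \<open>d\<^sub>1(g) = g\<close> they differ
  by \<open>f\<^sub>r\<^sub>+\<^sub>1\<close> at \<open>h\<^sup>r\<^sup>+\<^sup>1\<close>. Comparing this power gives \<open>J f\<^sub>r\<^sub>+\<^sub>1' + f\<^sub>r\<^sub>+\<^sub>1'\<^sup>T J = 0\<close>, so \<open>J f\<^sub>r\<^sub>+\<^sub>1\<close> has a symmetric
  Jacobian and is a gradient.
\<close>

section \<open>Calculus of smooth functions\<close>

lemma partials_append: "partials (\<alpha> @ \<beta>) f = partials \<alpha> (partials \<beta> f)"
  by (induction \<alpha>) simp_all

lemma partial_eqI: "(f has_derivative D) (at y) \<Longrightarrow> partials [i] f y = D (axis i 1)"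
  by (simp add: frechet_derivative_at[symmetric])

lemma smooth_differentiable: "smooth f \<Longrightarrow> f differentiable (at y)"
  unfolding smooth_def by (metis partials.simps(1))

lemma smooth_partials: "smooth f \<Longrightarrow> smooth (partials \<alpha> f)"
  unfolding smooth_def by (metis partials_append)

text \<open>Smoothness as a greatest fixed point: it is enough to exhibit a class of differentiable
  functions closed under partial derivatives. The induction peels off the last list entry because
  that derivative is applied first.\<close>

lemma smooth_coinduct:
  assumes "P f"
    and "\<And>f. P f \<Longrightarrow> (\<forall>y. f differentiable (at y)) \<and> (\<forall>i. P (partials [i] f))"
  shows "smooth f"
proof -
  have "\<forall>f. P f \<longrightarrow> P (partials \<alpha> f)" for \<alpha>
  proof (induction \<alpha> rule: rev_induct)
    case (snoc i \<alpha>)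
    then show ?case using assms(2) by (simp add: partials_append del: partials.simps(2))
  qed simp
  then show ?thesis using assms unfolding smooth_def by blast
qed

lemma smoothI:
  assumes "\<And>y. f differentiable (at y)" and "\<And>i. smooth (partials [i] f)"
  shows "smooth f"
  by (rule smooth_coinduct[where P = "\<lambda>g. g = f \<or> smooth g"])
     (use assms smooth_differentiable smooth_partials in blast)+

text \<open>Expanding the argument in the standard basis puts the abstract derivative into
  coordinates; the chain rules below rest on this form.\<close>

lemma differentiable_has_derivative_partials:
  fixes f :: "real ^ 'n::finite \<Rightarrow> 'b::real_normed_vector"
  assumes "f differentiable (at y)"
  shows "(f has_derivative (\<lambda>v. \<Sum>i\<in>UNIV. v $ i *\<^sub>R partials [i] f y)) (at y)"
proof -
  let ?D = "frechet_derivative f (at y)"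
  have D: "(f has_derivative ?D) (at y)" using assms by (simp add: frechet_derivative_works)
  then have "linear ?D" by (rule has_derivative_linear)
  then have "?D v = (\<Sum>i\<in>UNIV. v $ i *\<^sub>R partials [i] f y)" for v
    by (subst basis_expansion[symmetric, of v])
       (simp add: linear_sum linear_cmul scalar_mult_eq_scaleR)
  then show ?thesis by (intro has_derivative_eq_rhs[OF D] ext)
qed

lemmas smooth_has_derivative =
  differentiable_has_derivative_partials[OF smooth_differentiable]

lemma smooth_continuous_on: "smooth f \<Longrightarrow> continuous_on S f"
  by (intro differentiable_imp_continuous_on differentiable_at_imp_differentiable_on
      smooth_differentiable)

lemma smooth_const: "smooth (\<lambda>_. c)"
  by (rule smooth_coinduct[where P = "\<lambda>f. \<exists>c. f = (\<lambda>_. c)"]) auto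

lemma partial_bounded_linear:
  assumes "bounded_linear T" "f differentiable (at y)"
  shows "partials [i] (\<lambda>z. T (f z)) y = T (partials [i] f y)"
  using partial_eqI[OF bounded_linear.has_derivative[OF assms(1) assms(2)[unfolded frechet_derivative_works]], of i]
  by simp

lemma smooth_bounded_linear:
  assumes T: "bounded_linear T" and "smooth f"
  shows "smooth (\<lambda>y. T (f y))"
proof (rule smooth_coinduct[where P = "\<lambda>g. \<exists>f. smooth f \<and> g = (\<lambda>y. T (f y))"])
  fix g assume "\<exists>f. smooth f \<and> g = (\<lambda>y. T (f y))"
  then obtain f where f: "smooth f" and g: "g = (\<lambda>y. T (f y))" by blast
  have "g differentiable (at y)" for y
    using smooth_differentiable[OF f] T unfolding g differentiable_def
    by (blast intro: bounded_linear.has_derivative)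
  moreover have "partials [i] g = (\<lambda>y. T (partials [i] f y))" for i
    using partial_bounded_linear[OF T smooth_differentiable[OF f]] unfolding g by blast
  ultimately show "(\<forall>y. g differentiable (at y)) \<and>
      (\<forall>i. \<exists>f. smooth f \<and> partials [i] g = (\<lambda>y. T (f y)))"
    using smooth_partials[OF f] by blast
qed (use assms in blast)

lemma partials_bounded_linear:
  assumes T: "bounded_linear T" and f: "smooth f"
  shows "partials \<alpha> (\<lambda>z. T (f z)) = (\<lambda>z. T (partials \<alpha> f z))"
  using partial_bounded_linear[OF T smooth_differentiable[OF smooth_partials[OF f]]]
  by (induction \<alpha>) simp_all

lemma partial_add:
  assumes "f differentiable (at y)" "g differentiable (at y)"
  shows "partials [i] (\<lambda>z. f z + g z) y = partials [i] f y + partials [i] g y"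
  using partial_eqI[OF has_derivative_add[OF assms[unfolded frechet_derivative_works]], of i]
  by simp

lemma smooth_add:
  assumes "smooth f" "smooth g"
  shows "smooth (\<lambda>y. f y + g y)"
proof (rule smooth_coinduct[where P = "\<lambda>h. \<exists>f g. smooth f \<and> smooth g \<and> h = (\<lambda>y. f y + g y)"])
  fix h assume "\<exists>f g. smooth f \<and> smooth g \<and> h = (\<lambda>y. f y + g y)"
  then obtain f g where fg: "smooth f" "smooth g" and h: "h = (\<lambda>y. f y + g y)" by blast
  have "partials [i] h = (\<lambda>y. partials [i] f y + partials [i] g y)" for i
    using partial_add[OF fg[THEN smooth_differentiable]] unfolding h by blast
  moreover have "h differentiable (at y)" for y
    unfolding h using fg by (intro differentiable_add smooth_differentiable)
  ultimately show "(\<forall>y. h differentiable (at y)) \<and>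
      (\<forall>i. \<exists>f g. smooth f \<and> smooth g \<and> partials [i] h = (\<lambda>y. f y + g y))"
    using fg[THEN smooth_partials] by blast
qed (use assms in blast)

lemma smooth_sum:
  assumes "\<And>k. k \<in> A \<Longrightarrow> smooth (f k)"
  shows "smooth (\<lambda>y. \<Sum>k\<in>A. f k y)"
  using assms by (induction A rule: infinite_finite_induct) (simp_all add: smooth_const smooth_add)

lemma partials_add:
  assumes "smooth f" "smooth g"
  shows "partials \<alpha> (\<lambda>z. f z + g z) = (\<lambda>z. partials \<alpha> f z + partials \<alpha> g z)"
  using partial_add[OF assms[THEN smooth_partials, THEN smooth_differentiable]]
  by (induction \<alpha>) simp_all

lemma partials_zero: "partials \<alpha> (\<lambda>_. 0) = (\<lambda>_. 0)"
  by (induction \<alpha>) simp_all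

lemma partials_sum:
  assumes "\<And>k. k \<in> A \<Longrightarrow> smooth (f k)"
  shows "partials \<alpha> (\<lambda>z. \<Sum>k\<in>A. f k z) = (\<lambda>z. \<Sum>k\<in>A. partials \<alpha> (f k) z)"
  using assms
  by (induction A rule: infinite_finite_induct) (simp_all add: partials_zero partials_add smooth_sum)

lemma partial_bilinear:
  assumes "bounded_bilinear B" "f differentiable (at y)" "g differentiable (at y)"
  shows "partials [i] (\<lambda>z. B (f z) (g z)) y = B (partials [i] f y) (g y) + B (f y) (partials [i] g y)"
  using partial_eqI[OF bounded_bilinear.FDERIV[OF assms(1) assms(2,3)[unfolded frechet_derivative_works]], of i]
  by (simp add: add.commute)

text \<open>
  A single product is not closed under partial derivatives, but the sums of products are.
\<close>

inductive bilinear_sum ::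
  "('b::real_normed_vector \<Rightarrow> 'c::real_normed_vector \<Rightarrow> 'e::real_normed_vector) \<Rightarrow>
    (real ^ 'n::finite \<Rightarrow> 'e) \<Rightarrow> bool"
  for B :: "'b \<Rightarrow> 'c \<Rightarrow> 'e" where
  single: "smooth f \<Longrightarrow> smooth g \<Longrightarrow> bilinear_sum B (\<lambda>y. B (f y) (g y))"
| add: "bilinear_sum B h \<Longrightarrow> bilinear_sum B k \<Longrightarrow> bilinear_sum B (\<lambda>y. h y + k y)"

lemma smooth_bilinear:
  assumes B: "bounded_bilinear B" and "smooth f" "smooth g"
  shows "smooth (\<lambda>y. B (f y) (g y))"
proof (rule smooth_coinduct[where P = "bilinear_sum B"])
  show "bilinear_sum B (\<lambda>y. B (f y) (g y))" using assms by (intro bilinear_sum.single)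
  show "(\<forall>y. h differentiable (at y)) \<and> (\<forall>i. bilinear_sum B (partials [i] h))"
    if "bilinear_sum B h" for h
    using that
  proof induction
    case (single f g)
    have "partials [i] (\<lambda>z. B (f z) (g z)) =
        (\<lambda>z. B (partials [i] f z) (g z) + B (f z) (partials [i] g z))" for i
      using single by (intro ext partial_bilinear[OF B] smooth_differentiable)
    moreover have "(\<lambda>z. B (f z) (g z)) differentiable (at y)" for y
      using bounded_bilinear.FDERIV[OF B] single[THEN smooth_differentiable]
      unfolding differentiable_def by blast
    moreover have "bilinear_sum B (\<lambda>z. B (partials [i] f z) (g z) + B (f z) (partials [i] g z))" for i
      using single by (intro bilinear_sum.intros smooth_partials)
    ultimately show ?case by presburger
  next
    case (add h k)
    have "partials [i] (\<lambda>z. h z + k z) = (\<lambda>z. partials [i] h z + partials [i] k z)" for i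
      using add by (intro ext partial_add) blast+
    moreover have "bilinear_sum B (\<lambda>z. partials [i] h z + partials [i] k z)" for i
      using add by (intro bilinear_sum.intros) blast+
    ultimately show ?case using add by (auto simp del: partials.simps)
  qed
qed

section \<open>Differentiation along curves, symmetry of second partials, potentials\<close>

lemma smooth_chain:
  assumes "smooth f" "(g has_vector_derivative v) (at t within S)"
  shows "((\<lambda>s. f (g s)) has_vector_derivative (\<Sum>i\<in>UNIV. v $ i *\<^sub>R partials [i] f (g t))) (at t within S)"
  using has_derivative_compose[OF assms(2)[unfolded has_vector_derivative_def] smooth_has_derivative[OF assms(1)]]
  by (simp add: has_vector_derivative_def scaleR_sum_right del: partials.simps)

lemma smooth_along_axis:
  assumes "smooth f"
  shows "((\<lambda>s. f (a + s *\<^sub>R axis i 1)) has_vector_derivative partials [i] f (a + s *\<^sub>R axis i 1)) (at s within S)"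
proof -
  have "((\<lambda>s. a + s *\<^sub>R axis i 1) has_vector_derivative axis i 1) (at s within S)"
    by (auto intro!: derivative_eq_intros)
  from smooth_chain[OF assms this] show ?thesis
    by (simp add: axis_def if_distrib[of "\<lambda>c. c *\<^sub>R _"] cong: if_cong del: partials.simps)
qed

text \<open>
  Differentiate \<open>f(p(s,t)) - f(p(0,t)) = \<integral>\<^sub>0\<^sup>s \<partial>\<^sub>i f(p(\<tau>,t)) d\<tau>\<close> under the integral in \<open>t\<close>, and then the result in \<open>s\<close>.
\<close>

lemma partials_commute:
  fixes f :: "real ^ 'n::finite \<Rightarrow> 'b::banach"
  assumes f: "smooth f"
  shows "partials [i] (partials [j] f) y = partials [j] (partials [i] f) y"
proof -
  define p where "p s t = y + s *\<^sub>R axis i 1 + t *\<^sub>R axis j 1" for s t :: real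
  have p_eq: "p s t = y + t *\<^sub>R axis j 1 + s *\<^sub>R axis i 1" for s t
    by (simp add: p_def)
  let ?fij = "partials [j] (partials [i] f)"
  note sm = smooth_partials[OF f] smooth_partials[OF smooth_partials[OF f]]
  have cont: "continuous_on S (\<lambda>x. partials \<alpha> f (p (u x) (v x)))"
    if "continuous_on S u" "continuous_on S v" for S :: "'c::topological_space set" and u v \<alpha>
    unfolding p_def
    by (intro continuous_on_compose2[OF smooth_continuous_on[OF sm(1)[of \<alpha>], of UNIV]]
        continuous_intros that) simp
  have cont2: "continuous_on S (\<lambda>x. ?fij (p (u x) (v x)))"
    if "continuous_on S u" "continuous_on S v" for S :: "'c::topological_space set" and u v
    unfolding p_def
    by (intro continuous_on_compose2[OF smooth_continuous_on[OF sm(2)[of "[j]" "[i]"], of UNIV]]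
        continuous_intros that) simp
  have diff: "partials [j] f (p s 0) - partials [j] f (p 0 0) = integral {0..s} (\<lambda>\<tau>. ?fij (p \<tau> 0))"
    if "0 \<le> s" for s
  proof -
    have "((\<lambda>t. integral (cbox 0 s) (\<lambda>\<tau>. partials [i] f (p \<tau> t))) has_vector_derivative
        integral (cbox 0 s) (\<lambda>\<tau>. ?fij (p \<tau> 0))) (at 0 within UNIV)"
    proof (rule leibniz_rule_vector_derivative)
      show "((\<lambda>t. partials [i] f (p \<tau> t)) has_vector_derivative ?fij (p \<tau> t)) (at t within UNIV)" for \<tau> t
        unfolding p_def by (rule smooth_along_axis[OF sm(1)])
      show "(\<lambda>\<tau>. partials [i] f (p \<tau> t)) integrable_on cbox 0 s" for t
        by (intro integrable_continuous cont continuous_intros)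
      show "continuous_on (UNIV \<times> cbox 0 s) (\<lambda>(t, \<tau>). ?fij (p \<tau> t))"
        unfolding split_def by (intro cont2 continuous_intros)
    qed auto
    moreover have "integral (cbox 0 s) (\<lambda>\<tau>. partials [i] f (p \<tau> t)) = f (p s t) - f (p 0 t)" for t
      using fundamental_theorem_of_calculus[OF that, of "\<lambda>\<tau>. f (p \<tau> t)" "\<lambda>\<tau>. partials [i] f (p \<tau> t)"]
        smooth_along_axis[OF f, of "y + t *\<^sub>R axis j 1" i]
      by (simp add: p_eq integral_unique del: partials.simps)
    moreover have "((\<lambda>t. f (p s t) - f (p 0 t)) has_vector_derivative
        partials [j] f (p s 0) - partials [j] f (p 0 0)) (at 0)"
      unfolding p_def by (intro has_vector_derivative_diff smooth_along_axis[OF f])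
    ultimately show ?thesis
      by (simp add: vector_derivative_unique_at del: partials.simps)
  qed
  \<comment> \<open>Since \<open>diff\<close> holds for nonnegative \<open>s\<close>, both
    derivatives are taken at the left end of \<open>{0..1}\<close>, where vector derivatives are
    still unique.\<close>
  have "((\<lambda>s. partials [j] f (p s 0) - partials [j] f (p 0 0)) has_vector_derivative
      partials [i] (partials [j] f) (p 0 0)) (at 0 within {0..1})"
    unfolding p_def using smooth_along_axis[OF sm(1), of "[j]" y i 0 "{0..1}"]
    by (auto intro!: derivative_eq_intros simp del: partials.simps)
  moreover have "((\<lambda>s. integral {0..s} (\<lambda>\<tau>. ?fij (p \<tau> 0))) has_vector_derivative ?fij (p 0 0)) (at 0 within {0..1})"
    by (intro integral_has_vector_derivative cont2 continuous_intros) auto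
  then have "((\<lambda>s. partials [j] f (p s 0) - partials [j] f (p 0 0)) has_vector_derivative ?fij (p 0 0)) (at 0 within {0..1})"
    by (rule has_vector_derivative_transform[rotated 2]) (auto simp: diff simp del: partials.simps)
  ultimately have "partials [i] (partials [j] f) (p 0 0) = ?fij (p 0 0)"
    using vector_derivative_unique_within_closed_interval[of 0 1 0] by simp
  then show ?thesis by (simp add: p_def del: partials.simps)
qed

lemma partial_nth:
  fixes G :: "real ^ 'n::finite \<Rightarrow> real ^ 'm"
  shows "G differentiable (at y) \<Longrightarrow> partials [i] (\<lambda>z. G z $ k) y = partials [i] G y $ k"
  by (rule partial_bounded_linear[OF bounded_linear_vec_nth])

text \<open>The Poincare lemma for a closed one-form on the whole space: the potential is the line
  integral of \<open>G\<close> along the segment from the origin to \<open>y\<close>.\<close>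

lemma gradient_potential:
  fixes G :: "real ^ 'n::finite \<Rightarrow> real ^ 'n"
  assumes G: "smooth G" and sym: "\<And>i j y. partials [i] G y $ j = partials [j] G y $ i"
  obtains K where "smooth K" "\<And>y. grad K y = G y"
proof -
  \<comment> \<open>\<open>w\<close> plays two roles: it is the \<open>t\<close>-derivative of
    \<open>t *\<^sub>R G (t *\<^sub>R y)\<close>, so its integral over the unit interval is
    \<open>G y\<close>; and, by the symmetry of the Jacobian, it is the gradient in \<open>y\<close>
    of the integrand of \<open>K\<close>.\<close>
  define w where "w y t = G (t *\<^sub>R y) + t *\<^sub>R (\<Sum>k\<in>UNIV. y $ k *\<^sub>R partials [k] G (t *\<^sub>R y))" for y t
  define K where "K y = integral (cbox 0 1) (\<lambda>t. y \<bullet> G (t *\<^sub>R y))" for y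
  have cont: "continuous_on S (\<lambda>x. partials \<alpha> G (u x *\<^sub>R v x))"
    if "continuous_on S u" "continuous_on S v" for S :: "'c::topological_space set" and u v \<alpha>
    by (intro continuous_on_compose2[OF smooth_continuous_on[OF smooth_partials[OF G, of \<alpha>], of UNIV]]
        continuous_intros that) simp
  note cont0 = cont[of _ _ _ "[]", unfolded partials.simps(1)]
  have sym': "y \<bullet> (\<Sum>k\<in>UNIV. v $ k *\<^sub>R partials [k] G z) = v \<bullet> (\<Sum>k\<in>UNIV. y $ k *\<^sub>R partials [k] G z)"
    for y v z
  proof -
    have "y \<bullet> (\<Sum>k\<in>UNIV. v $ k *\<^sub>R partials [k] G z) = (\<Sum>l\<in>UNIV. \<Sum>k\<in>UNIV. y $ l * (v $ k * partials [k] G z $ l))"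
      by (simp add: inner_vec_def sum_distrib_left del: partials.simps)
    also have "\<dots> = (\<Sum>k\<in>UNIV. \<Sum>l\<in>UNIV. y $ l * (v $ k * partials [l] G z $ k))"
      by (subst sum.swap, intro sum.cong refl, subst sym, rule refl)
    also have "\<dots> = v \<bullet> (\<Sum>k\<in>UNIV. y $ k *\<^sub>R partials [k] G z)"
      by (simp add: inner_vec_def sum_distrib_left mult.left_commute del: partials.simps)
    finally show ?thesis .
  qed
  have int_w: "(w y has_integral G y) (cbox 0 1)" for y
  proof -
    have "((\<lambda>t. t *\<^sub>R y) has_vector_derivative y) (at t within S)" for t S
      by (auto intro!: derivative_eq_intros)
    from has_vector_derivative_scaleR[OF DERIV_ident smooth_chain[OF G this]]
    have "((\<lambda>t. t *\<^sub>R G (t *\<^sub>R y)) has_vector_derivative w y t) (at t within {0..1})" for t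
      by (simp add: w_def add.commute del: partials.simps)
    from fundamental_theorem_of_calculus[OF zero_le_one this] show ?thesis by simp
  qed
  have K: "(K has_derivative (\<lambda>v. G y \<bullet> v)) (at y)" for y
  proof -
    \<comment> \<open>The Leibniz rule takes operator-valued derivatives, so the functional
      \<open>v \<bullet> w y t\<close> of \<open>v\<close> enters as a \<open>blinfun\<close>.
      Symmetry of the Jacobian comes in through \<open>sym'\<close>.\<close>
    have "(K has_derivative integral (cbox 0 1) (\<lambda>t. blinfun_inner_left (w y t))) (at y within UNIV)"
      unfolding K_def
    proof (rule leibniz_rule)
      fix z and t :: real
      have "((\<lambda>y. G (t *\<^sub>R y)) has_derivative (\<lambda>v. t *\<^sub>R (\<Sum>k\<in>UNIV. v $ k *\<^sub>R partials [k] G (t *\<^sub>R z)))) (at z)"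
        using has_derivative_compose[OF has_derivative_scaleR_right[OF has_derivative_ident]
            smooth_has_derivative[OF G], of t z UNIV]
        by (simp add: scaleR_sum_right del: partials.simps)
      from has_derivative_inner[OF has_derivative_ident this]
      show "((\<lambda>y. y \<bullet> G (t *\<^sub>R y)) has_derivative blinfun_apply (blinfun_inner_left (w z t))) (at z within UNIV)"
        by (rule has_derivative_eq_rhs)
           (simp add: fun_eq_iff w_def sym'[of z] inner_add_right del: partials.simps)
    next
      show "(\<lambda>t. z \<bullet> G (t *\<^sub>R z)) integrable_on cbox 0 1" for z
        by (intro integrable_continuous cont0 continuous_intros)
      show "continuous_on (UNIV \<times> cbox 0 1) (\<lambda>(y, t). blinfun_inner_left (w y t))"
        unfolding split_def w_def
        by (intro bounded_linear.continuous_on[OF bounded_linear_blinfun_inner_left] cont cont0 continuous_intros)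
    qed auto
    moreover have "integral (cbox 0 1) (\<lambda>t. blinfun_inner_left (w y t)) = blinfun_inner_left (G y)"
      using has_integral_linear[OF int_w bounded_linear_blinfun_inner_left]
      by (simp add: o_def integral_unique)
    ultimately show ?thesis by (simp add: inner_commute)
  qed
  have partial_K: "partials [i] K = (\<lambda>y. G y $ i)" for i
    using partial_eqI[OF K] by (simp add: fun_eq_iff inner_axis del: partials.simps)
  show ?thesis
  proof
    show "smooth K"
    proof (rule smoothI)
      show "K differentiable (at y)" for y using K unfolding differentiable_def by blast
      show "smooth (partials [i] K)" for i
        unfolding partial_K by (rule smooth_bounded_linear[OF bounded_linear_vec_nth G])
    qed
    show "grad K y = G y" for y
      unfolding grad_def partial_K by simp
  qed
qed

section \<open>Asymptotic expansions and differential polynomials\<close>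

lemma norm_bigo_add:
  assumes "(\<lambda>x. norm (f x)) \<in> O[F](g)" "(\<lambda>x. norm (k x)) \<in> O[F](g)"
  shows "(\<lambda>x. norm (f x + k x)) \<in> O[F](g)"
proof -
  have "(\<lambda>x. norm (f x + k x)) \<in> O[F](\<lambda>x. norm (f x) + norm (k x))"
    by (intro bigoI[of _ 1] always_eventually) (simp add: norm_triangle_ineq)
  then show ?thesis using sum_in_bigo(1)[OF assms] by (rule landau_o.big_trans)
qed

lemma norm_bigo_sum:
  assumes "\<And>k. k \<in> A \<Longrightarrow> (\<lambda>x. norm (f k x)) \<in> O[F](g)"
  shows "(\<lambda>x. norm (\<Sum>k\<in>A. f k x)) \<in> O[F](g)"
  using assms by (induction A rule: infinite_finite_induct) (simp_all add: norm_bigo_add)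

lemma expands_bounded_linear:
  assumes T: "bounded_linear T" and u: "expands u c"
  shows "expands (\<lambda>h. T (u h)) (\<lambda>n. T (c n))"
  unfolding expands_def
proof
  fix N
  interpret bounded_linear T by fact
  obtain K where K: "\<And>x. norm (T x) \<le> norm x * K" using bounded by blast
  have "T (u h) - (\<Sum>j\<le>N. h ^ j *\<^sub>R T (c j)) = T (u h - (\<Sum>j\<le>N. h ^ j *\<^sub>R c j))" for h
    by (simp add: diff sum scaleR)
  then have "(\<lambda>h. norm (T (u h) - (\<Sum>j\<le>N. h ^ j *\<^sub>R T (c j)))) \<in>
      O[at_right 0](\<lambda>h. norm (u h - (\<Sum>j\<le>N. h ^ j *\<^sub>R c j)))"
    using K by (intro bigoI[of _ K] always_eventually) (simp add: mult.commute)
  then show "(\<lambda>h. norm (T (u h) - (\<Sum>j\<le>N. h ^ j *\<^sub>R T (c j)))) \<in> O[at_right 0](\<lambda>h. h ^ Suc N)"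
    by (rule landau_o.big_trans) (use u expands_def in blast)
qed

lemma eventually_small_at_right_0: "\<forall>\<^sub>F h in at_right 0. 0 < h \<and> h < (1::real)"
  by (auto simp: eventually_at_right[of 0 1] intro!: exI[of _ 1])

lemma power_bigo_at_right_0:
  assumes "m \<le> n"
  shows "(\<lambda>h::real. h ^ n) \<in> O[at_right 0](\<lambda>h. h ^ m)"
proof (rule bigoI)
  show "\<forall>\<^sub>F h in at_right 0. norm (h ^ n) \<le> 1 * norm (h ^ m :: real)"
    using eventually_small_at_right_0
  proof eventually_elim
    case (elim h)
    then show ?case using power_decreasing[OF assms, of h] by simp
  qed
qed

lemma norm_power_bigo:
  assumes "m \<le> n"
  shows "(\<lambda>h::real. norm (h ^ n *\<^sub>R x)) \<in> O[at_right 0](\<lambda>h. h ^ m)"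
proof (rule landau_o.big_trans)
  show "(\<lambda>h::real. norm (h ^ n *\<^sub>R x)) \<in> O[at_right 0](\<lambda>h. h ^ n)"
    by (intro bigoI[of _ "norm x"] always_eventually) simp
qed (rule power_bigo_at_right_0[OF assms])

lemma expands_bigo_1:
  assumes "expands u c"
  shows "(\<lambda>h. norm (u h)) \<in> O[at_right 0](\<lambda>_. 1)"
proof -
  have "(\<lambda>h. norm (u h - (\<Sum>j\<le>0. h ^ j *\<^sub>R c j))) \<in> O[at_right 0](\<lambda>h. h ^ 0)"
    using assms power_bigo_at_right_0[of 0 "Suc 0"] unfolding expands_def
    by (blast intro: landau_o.big_trans)
  from norm_bigo_add[OF this norm_power_bigo[of 0 0 "c 0"]] show ?thesis by simp
qed

text \<open>The Cauchy product of two expansions. With truncations \<open>P\<close> and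
  \<open>Q\<close>, the error splits into \<open>B (P h) (v h - Q h)\<close>,
  \<open>B (u h - P h) (v h)\<close> and the terms of \<open>B (P h) (Q h)\<close> of order above
  \<open>N\<close>. In the first two, one factor is a remainder and the other is bounded.\<close>

lemma expands_bilinear:
  assumes B: "bounded_bilinear B" and u: "expands u c" and v: "expands v d"
  shows "expands (\<lambda>h. B (u h) (v h)) (\<lambda>n. \<Sum>a\<le>n. B (c a) (d (n - a)))"
  unfolding expands_def
proof
  fix N
  interpret bounded_bilinear B by fact
  from bounded obtain K where K: "\<forall>x y. norm (B x y) \<le> norm x * norm y * K" ..
  define P where "P h = (\<Sum>j\<le>N. h ^ j *\<^sub>R c j)" for h :: real
  define Q where "Q h = (\<Sum>j\<le>N. h ^ j *\<^sub>R d j)" for h :: real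
  let ?O = "O[at_right 0](\<lambda>h::real. h ^ Suc N)"
  have mult: "(\<lambda>h. norm (B (f h) (g h))) \<in> ?O"
    if "(\<lambda>h. norm (f h) * norm (g h)) \<in> ?O" for f g
  proof -
    have "(\<lambda>h. norm (B (f h) (g h))) \<in> O[at_right 0](\<lambda>h. norm (f h) * norm (g h))"
      using K by (intro bigoI[of _ K] always_eventually) (simp add: mult_ac)
    then show ?thesis using that by (rule landau_o.big_trans)
  qed
  have uP: "(\<lambda>h. norm (u h - P h)) \<in> ?O" and vQ: "(\<lambda>h. norm (v h - Q h)) \<in> ?O"
    using u v unfolding expands_def P_def Q_def by blast+
  have "(\<lambda>h. norm (P h)) \<in> O[at_right 0](\<lambda>_. 1)"
    unfolding P_def by (intro norm_bigo_sum norm_power_bigo[OF le0, unfolded power_0])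
  then have 1: "(\<lambda>h. norm (B (P h) (v h - Q h))) \<in> ?O"
    using vQ by (intro mult) (use landau_o.big.mult in fastforce)
  have 2: "(\<lambda>h. norm (B (u h - P h) (v h))) \<in> ?O"
    using uP expands_bigo_1[OF v] by (intro mult) (use landau_o.big.mult in fastforce)
  \<comment> \<open>\<open>?T\<close> collects the index pairs that the truncated Cauchy product
    keeps; off it, \<open>a + b\<close> is at least \<open>Suc N\<close>.\<close>
  let ?D = "{..N} \<times> {..N}" and ?T = "{(a, b). a + b \<le> N}"
  have 3: "(\<lambda>h. norm (\<Sum>(a, b)\<in>?D - ?T. h ^ (a + b) *\<^sub>R B (c a) (d b))) \<in> ?O"
    unfolding split_def by (intro norm_bigo_sum norm_power_bigo) auto
  have eq: "B (u h) (v h) - (\<Sum>n\<le>N. h ^ n *\<^sub>R (\<Sum>a\<le>n. B (c a) (d (n - a)))) =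
      B (P h) (v h - Q h) + B (u h - P h) (v h) + (\<Sum>(a, b)\<in>?D - ?T. h ^ (a + b) *\<^sub>R B (c a) (d b))"
    for h
  proof -
    have "B (P h) (Q h) = (\<Sum>(a, b)\<in>?D. h ^ (a + b) *\<^sub>R B (c a) (d b))"
      unfolding sum.cartesian_product[symmetric]
      by (subst sum.swap) (simp add: P_def Q_def sum_left sum_right scaleR_left scaleR_right
          power_add scaleR_sum_right mult.commute)
    also have "\<dots> = (\<Sum>(a, b)\<in>?D - ?T. h ^ (a + b) *\<^sub>R B (c a) (d b)) +
        (\<Sum>(a, b)\<in>?T. h ^ (a + b) *\<^sub>R B (c a) (d b))"
      by (intro sum.subset_diff) auto
    also have "(\<Sum>(a, b)\<in>?T. h ^ (a + b) *\<^sub>R B (c a) (d b)) =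
        (\<Sum>n\<le>N. h ^ n *\<^sub>R (\<Sum>a\<le>n. B (c a) (d (n - a))))"
      by (simp add: sum.triangle_reindex_eq scaleR_sum_right)
    finally show ?thesis by (simp add: diff_left diff_right)
  qed
  show "(\<lambda>h. norm (B (u h) (v h) - (\<Sum>n\<le>N. h ^ n *\<^sub>R (\<Sum>a\<le>n. B (c a) (d (n - a)))))) \<in> ?O"
    unfolding eq by (intro norm_bigo_add 1 2 3)
qed

text \<open>Once the lower coefficients vanish, dividing the remainder estimate by
  \<open>h ^ n\<close> bounds \<open>norm (c n)\<close> by a multiple of \<open>h\<close>, which
  tends to 0.\<close>

lemma expands_zero_unique:
  assumes u: "expands u c" and zero: "\<forall>\<^sub>F h in at_right 0. u h = 0"
  shows "c n = 0"
proof (induction n rule: less_induct)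
  case (less n)
  have "(\<Sum>j\<le>n. h ^ j *\<^sub>R c j) = (\<Sum>j\<in>{n}. h ^ j *\<^sub>R c j)" for h :: real
    using less by (intro sum.mono_neutral_right) auto
  then have "(\<lambda>h. norm (u h - h ^ n *\<^sub>R c n)) \<in> O[at_right 0](\<lambda>h. h ^ Suc n)"
    using u unfolding expands_def by (auto dest!: spec[of _ n])
  then obtain C where "\<forall>\<^sub>F h in at_right 0. norm (norm (u h - h ^ n *\<^sub>R c n)) \<le> C * norm (h ^ Suc n)"
    by (rule landau_o.bigE)
  with zero eventually_small_at_right_0 have "\<forall>\<^sub>F h in at_right 0. norm (c n) \<le> C * h"
  proof eventually_elim
    case (elim h)
    then have "h ^ n * norm (c n) \<le> h ^ n * (C * h)" by (simp add: mult_ac power_abs)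
    then show ?case using elim by (simp add: mult_le_cancel_left_pos)
  qed
  moreover have "((\<lambda>h. C * h) \<longlongrightarrow> C * 0) (at_right 0)" by (intro tendsto_intros)
  ultimately have "norm (c n) \<le> C * 0" by (intro tendsto_lowerbound) auto
  then show ?case by simp
qed

text \<open>Subtracting the constant changes only the coefficient of order 0 and reduces the claim
  to the zero function.\<close>

lemma expands_const_unique:
  assumes u: "expands u c" and const: "\<forall>\<^sub>F h in at_right 0. u h = w" and "n \<noteq> 0"
  shows "c n = 0"
proof -
  have "(\<Sum>j\<le>N. h ^ j *\<^sub>R (c j - (if j = 0 then w else 0))) = (\<Sum>j\<le>N. h ^ j *\<^sub>R c j) - w"
    for N and h :: real
    by (simp add: scaleR_diff_right sum_subtractf if_distrib[of "\<lambda>x. _ *\<^sub>R x"] cong: if_cong)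
  then have "expands (\<lambda>h. u h - w) (\<lambda>j. c j - (if j = 0 then w else 0))"
    using u by (simp add: expands_def)
  moreover have "\<forall>\<^sub>F h in at_right 0. u h - w = 0" using const by eventually_elim simp
  ultimately show ?thesis using expands_zero_unique[of "\<lambda>h. u h - w" _ n] \<open>n \<noteq> 0\<close> by fastforce
qed

section \<open>Substituting formal series into differential polynomials\<close>

lemma dpoly_eval_hom:
  assumes "\<And>x y. \<psi> (x + y) = \<psi> x + \<psi> y" "\<And>x y. \<psi> (x * y) = \<psi> x * \<psi> y"
  shows "\<psi> (dpoly_eval c u p) = dpoly_eval (\<lambda>r. \<psi> (c r)) (\<lambda>i \<alpha>. \<psi> (u i \<alpha>)) p"
  by (induction p) (simp_all add: assms)

text \<open>Coefficient \<open>k\<close> of a product involves only coefficients of the factors up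
  to \<open>k\<close>, so truncating the series beyond \<open>n\<close> is harmless.\<close>

lemma dpoly_eval_fps_cong:
  assumes "\<And>i \<alpha> k. k \<le> n \<Longrightarrow> fps_nth (u i \<alpha>) k = fps_nth (v i \<alpha>) k" "k \<le> n"
  shows "fps_nth (dpoly_eval c u p) k = fps_nth (dpoly_eval c v p) k"
  using assms(2) by (induction p arbitrary: k) (simp_all add: assms(1) fps_mult_nth)

text \<open>
  Evaluating \<open>d\<^sub>1(g) = g\<close> on the polynomial families \<open>g = \<Sum>\<^sub>k\<^sub>\<le>\<^sub>n h\<^sup>k G (Suc k)\<close> for all real \<open>h\<close> yields an
  identity of polynomials in \<open>h\<close>, hence one of the coefficients.
\<close>

lemma dpoly_series_order_1:
  assumes d: "order_at_least_1 d" and G: "\<And>k. k \<ge> 1 \<Longrightarrow> smooth (G k)"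
  shows "fps_nth (dpoly_series (d 1 i) G y) n = G (Suc n) y $ i"
proof -
  \<comment> \<open>The jets of the truncated family, kept as polynomials in \<open>h\<close>.
    Degree \<open>n\<close> is enough for the coefficient of order \<open>n\<close>.\<close>
  define q :: "'a \<Rightarrow> 'a list \<Rightarrow> real poly" where
    "q i \<alpha> = (\<Sum>k\<le>n. monom (partials \<alpha> (\<lambda>z. G (Suc k) z $ i) y) k)" for i \<alpha>
  define g where "g h z = (\<Sum>k\<le>n. h ^ k *\<^sub>R G (Suc k) z)" for h z
  let ?P = "dpoly_eval (\<lambda>r. [:r:]) q (d 1 i)"
  have sm: "smooth (\<lambda>z. h ^ k *\<^sub>R G (Suc k) z)" for h k
    by (intro smooth_bounded_linear[OF bounded_linear_scaleR_right] G) simp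
  have g: "smooth (g h)" for h
    unfolding g_def by (intro smooth_sum sm)
  have nth: "smooth (\<lambda>z. G (Suc k) z $ j)" for k j
    by (intro smooth_bounded_linear[OF bounded_linear_vec_nth] G) simp
  have "poly (q j \<alpha>) h = partials \<alpha> (\<lambda>z. g h z $ j) y" for j \<alpha> h
    using partials_bounded_linear[OF bounded_linear_scaleR_right nth]
      partials_sum[of "{..n}" "\<lambda>k z. h ^ k *\<^sub>R (G (Suc k) z $ j)" \<alpha>,
        OF smooth_bounded_linear[OF bounded_linear_scaleR_right nth]]
    by (simp add: q_def g_def poly_sum poly_monom mult.commute)
  \<comment> \<open>Evaluation at \<open>h\<close>, and further below \<open>fps_of_poly\<close>,
    are ring homomorphisms, so they commute with evaluating a differential polynomial.\<close>
  then have "poly ?P h = dpoly_at (d 1 i) (g h) y" for h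
    by (simp add: dpoly_at_def dpoly_eval_hom[of "\<lambda>p. poly p h"])
  also have "dpoly_at (d 1 i) (g h) y = poly (q i []) h" for h
    using d g by (simp add: order_at_least_1_def q_def g_def poly_sum poly_monom mult.commute)
  finally have P: "?P = q i []" by (simp add: poly_eq_poly_eq_iff[symmetric] fun_eq_iff)
  have "fps_nth (dpoly_series (d 1 i) G y) n =
      fps_nth (dpoly_eval fps_const (\<lambda>i \<alpha>. fps_of_poly (q i \<alpha>)) (d 1 i)) n"
    unfolding dpoly_series_def
    by (rule dpoly_eval_fps_cong[of n]) (simp_all add: q_def coeff_sum)
  also have "\<dots> = coeff ?P n"
    using dpoly_eval_hom[of fps_of_poly "\<lambda>r. [:r:]" q "d 1 i"]
    by (simp add: fps_of_poly_add fps_of_poly_mult fps_of_poly_const flip: fps_of_poly_nth)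
  also have "\<dots> = G (Suc n) y $ i"
    unfolding P by (simp add: q_def coeff_sum)
  finally show ?thesis .
qed

lemma dpoly_series_cong:
  assumes "\<And>k. k \<le> n \<Longrightarrow> F (Suc k) = G (Suc k)"
  shows "fps_nth (dpoly_series p F y) n = fps_nth (dpoly_series p G y) n"
  unfolding dpoly_series_def by (rule dpoly_eval_fps_cong[of n]) (simp_all add: assms)

text \<open>Each \<open>d j\<close> comes with the factor \<open>h ^ j\<close>, where
  \<open>j\<close> is at least 1, so order \<open>n\<close> sees the fields with index at most
  \<open>n\<close> only.\<close>

lemma step_coeff_cong:
  assumes "\<And>k. 1 \<le> k \<Longrightarrow> k \<le> n \<Longrightarrow> F k = G k"
  shows "step_coeff d F n = step_coeff d G n"
  unfolding step_coeff_def
  by (auto simp: fun_eq_iff vec_eq_iff intro!: sum.cong dpoly_series_cong assms)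

text \<open>Only the summand \<open>j = 1\<close> reaches the field with index \<open>Suc r\<close>,
  and there \<open>order_at_least_1\<close> makes the dependence the identity. The summands from
  \<open>j = 2\<close> on involve indices up to \<open>r\<close>, where \<open>F\<close> and
  \<open>G\<close> agree.\<close>

lemma step_coeff_Suc_diff:
  assumes d: "order_at_least_1 d" and smooth: "\<And>k. k \<ge> 1 \<Longrightarrow> smooth (F k)" "\<And>k. k \<ge> 1 \<Longrightarrow> smooth (G k)"
    and eq: "\<And>k. 1 \<le> k \<Longrightarrow> k \<le> r \<Longrightarrow> F k = G k"
  shows "step_coeff d F (Suc r) y - step_coeff d G (Suc r) y = F (Suc r) y - G (Suc r) y"
proof -
  have "(\<Sum>j = Suc 1..Suc r. fps_nth (dpoly_series (d j i) F y) (Suc r - j)) =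
      (\<Sum>j = Suc 1..Suc r. fps_nth (dpoly_series (d j i) G y) (Suc r - j))" for i
    by (intro sum.cong refl dpoly_series_cong eq) auto
  moreover have "(\<Sum>j = 1..Suc r. u j) = u 1 + (\<Sum>j = Suc 1..Suc r. u j)" for u :: "nat \<Rightarrow> real"
    by (rule sum.atLeast_Suc_atMost) simp
  ultimately show ?thesis
    unfolding step_coeff_def
    by (simp add: vec_eq_iff dpoly_series_order_1[OF d smooth(1), unfolded One_nat_def]
        dpoly_series_order_1[OF d smooth(2), unfolded One_nat_def] del: sum.cl_ivl_Suc)
qed

section \<open>Lie derivatives and the Taylor coefficients of a flow\<close>

definition lie :: "(real ^ 'n::finite \<Rightarrow> real ^ 'n) \<Rightarrow> (real ^ 'n \<Rightarrow> 'b::real_normed_vector) \<Rightarrow> real ^ 'n \<Rightarrow> 'b" where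
  "lie f c y = (\<Sum>k\<in>UNIV. f y $ k *\<^sub>R partials [k] c y)"

lemma smooth_lie: "smooth f \<Longrightarrow> smooth c \<Longrightarrow> smooth (lie f c)"
  unfolding lie_def
  by (intro smooth_sum smooth_bilinear[OF bounded_bilinear_scaleR]
      smooth_bounded_linear[OF bounded_linear_vec_nth] smooth_partials)

text \<open>The commutator of a coordinate derivative with the Lie derivative along \<open>f\<close>
  is the Lie derivative along the differentiated field, because second partials commute.\<close>

lemma partial_lie:
  fixes c :: "real ^ 'n::finite \<Rightarrow> 'b::banach"
  assumes f: "smooth f" and c: "smooth c"
  shows "partials [i] (lie f c) y =
    lie f (partials [i] c) y + (\<Sum>k\<in>UNIV. partials [i] f y $ k *\<^sub>R partials [k] c y)"
proof -
  have fk: "smooth (\<lambda>z. f z $ k)" for k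
    by (rule smooth_bounded_linear[OF bounded_linear_vec_nth f])
  have "partials [i] (lie f c) y = (\<Sum>k\<in>UNIV. partials [i] (\<lambda>z. f z $ k *\<^sub>R partials [k] c z) y)"
    unfolding lie_def
    by (subst partials_sum)
       (intro smooth_bilinear[OF bounded_bilinear_scaleR] smooth_partials fk c refl)+
  also have "\<dots> = (\<Sum>k\<in>UNIV. partials [i] f y $ k *\<^sub>R partials [k] c y +
      f y $ k *\<^sub>R partials [k] (partials [i] c) y)"
    by (intro sum.cong refl, subst partial_bilinear[OF bounded_bilinear_scaleR])
       (intro smooth_differentiable fk smooth_partials c
         | simp only: partial_nth[OF smooth_differentiable[OF f]] partials_commute[OF c, of i])+
  finally show ?thesis by (simp add: lie_def sum.distrib add.commute del: partials.simps)
qed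

lemma lie_bilinear:
  assumes B: "bounded_bilinear B" and "smooth u" "smooth v"
  shows "lie f (\<lambda>y. B (u y) (v y)) y = B (lie f u y) (v y) + B (u y) (lie f v y)"
proof -
  interpret bounded_bilinear B by fact
  show ?thesis
    unfolding lie_def partial_bilinear[OF B assms(2,3)[THEN smooth_differentiable]]
    by (simp add: sum_left sum_right scaleR_left scaleR_right scaleR_add_right sum.distrib del: partials.simps)
qed

lemma lie_sum:
  assumes "\<And>k. k \<in> A \<Longrightarrow> smooth (u k)"
  shows "lie f (\<lambda>y. \<Sum>k\<in>A. u k y) y = (\<Sum>k\<in>A. lie f (u k) y)"
proof -
  have "partials [k] (\<lambda>y. \<Sum>k\<in>A. u k y) y = (\<Sum>l\<in>A. partials [k] (u l) y)" for k
    using partials_sum[of A u "[k]"] assms by meson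
  then show ?thesis
    unfolding lie_def by (simp only: scaleR_sum_right) (rule sum.swap)
qed

text \<open>
  With \<open>W n i j = \<Sum>\<^sub>a B(\<partial>\<^sub>i c\<^sub>a, \<partial>\<^sub>j c\<^sub>n\<^sub>-\<^sub>a)\<close> the recursion for \<open>c\<close> becomes
  \<open>(n+1) W\<^sub>n\<^sub>+\<^sub>1 = L\<^sub>f W\<^sub>n + (f')\<^sup>T W\<^sub>n + W\<^sub>n f'\<close>.
\<close>

lemma lie_series_preserves_bilinear:
  fixes B :: "real ^ 'n \<Rightarrow> real ^ 'n \<Rightarrow> real" and f :: "real ^ 'n::finite \<Rightarrow> real ^ 'n"
  assumes B: "bounded_bilinear B" and f: "smooth f" and c: "\<And>n. smooth (c n)"
    and c_0: "c 0 = (\<lambda>y. y)"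
    and c_Suc: "\<And>n. (\<lambda>y. real (Suc n) *\<^sub>R c (Suc n) y) = lie f (c n)"
    and infinitesimal: "\<And>i j y. B (partials [i] f y) (axis j 1) + B (axis i 1) (partials [j] f y) = 0"
    and "n \<noteq> 0"
  shows "(\<Sum>a\<le>n. B (partials [i] (c a) y) (partials [j] (c (n - a)) y)) = 0"
proof -
  interpret bounded_bilinear B by fact
  define W where "W n i j y = (\<Sum>a\<le>n. B (partials [i] (c a) y) (partials [j] (c (n - a)) y))" for n i j y
  note smc = smooth_partials[OF c]
  have pc_Suc: "real (Suc n) *\<^sub>R partials [i] (c (Suc n)) y =
      lie f (partials [i] (c n)) y + (\<Sum>k\<in>UNIV. partials [i] f y $ k *\<^sub>R partials [k] (c n) y)" for n i y
    using partial_bounded_linear[OF bounded_linear_scaleR_right smooth_differentiable[OF c], of i "real (Suc n)" "Suc n" y]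
    unfolding c_Suc partial_lie[OF f c] by simp
  have c0: "partials [i] (c 0) y = axis i 1" for i y
    by (simp add: c_0)
  have rec: "real (Suc n) * W (Suc n) i j y = lie f (W n i j) y +
      (\<Sum>k\<in>UNIV. partials [i] f y $ k * W n k j y) + (\<Sum>k\<in>UNIV. partials [j] f y $ k * W n i k y)"
    for n i j y
  proof -
    let ?X = "\<lambda>a. partials [i] (c a) y" and ?Y = "\<lambda>a. partials [j] (c a) y"
    \<comment> \<open>The weight \<open>Suc n\<close> is split as \<open>a + (Suc n - a)\<close>, so
      that each factor of \<open>B\<close> receives the weight its own recursion asks for. The end
      terms \<open>a = 0\<close> and \<open>a = Suc n\<close>, respectively, have weight
      zero.\<close>
    have "real (Suc n) * W (Suc n) i j y =
        (\<Sum>a\<le>Suc n. real a * B (?X a) (?Y (Suc n - a))) +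
        (\<Sum>a\<le>Suc n. real (Suc n - a) * B (?X a) (?Y (Suc n - a)))"
      unfolding W_def sum_distrib_left sum.distrib[symmetric]
      by (intro sum.cong refl) (auto simp: of_nat_diff algebra_simps simp del: partials.simps)
    also have "(\<Sum>a\<le>Suc n. real a * B (?X a) (?Y (Suc n - a))) =
        (\<Sum>a\<le>n. B (real (Suc a) *\<^sub>R ?X (Suc a)) (?Y (n - a)))"
      by (subst sum.atMost_Suc_shift) (simp add: scaleR_left del: partials.simps)
    also have "(\<Sum>a\<le>Suc n. real (Suc n - a) * B (?X a) (?Y (Suc n - a))) =
        (\<Sum>a\<le>n. B (?X a) (real (Suc (n - a)) *\<^sub>R ?Y (Suc (n - a))))"
      by (simp add: scaleR_right Suc_diff_le add_diff_eq del: partials.simps)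
    moreover have "lie f (W n i j) y =
        (\<Sum>a\<le>n. B (lie f (partials [i] (c a)) y) (?Y (n - a)) + B (?X a) (lie f (partials [j] (c (n - a))) y))"
      unfolding W_def[abs_def]
      by (subst lie_sum) (intro smooth_bilinear[OF B] smc sum.cong refl lie_bilinear[OF B])+
    ultimately show ?thesis
      unfolding pc_Suc
      by (simp add: W_def add_left add_right sum_left sum_right scaleR_left scaleR_right
          sum.distrib sum_distrib_left sum.swap[of _ "UNIV :: 'n set"] del: partials.simps)
  qed
  have "W (Suc n) i j y = 0" for n i j y
  proof (induction n arbitrary: i j y)
    \<comment> \<open>\<open>W 0\<close> is constant in \<open>y\<close>, so its Lie derivative
      vanishes; what remains of the recursion is exactly the infinitesimal invariance of
      \<open>B\<close>.\<close>
    case 0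
    have W_0: "W 0 i j y = B (axis i 1) (axis j 1)" for i j y
      by (simp add: W_def c0 del: partials.simps)
    have "lie f (W 0 i j) y = 0"
      by (simp add: lie_def W_0[abs_def])
    moreover have "(\<Sum>k\<in>UNIV. v $ k * B (axis k 1) w) = B v w"
      and "(\<Sum>k\<in>UNIV. v $ k * B w (axis k 1)) = B w v" for v w
    proof -
      have v: "(\<Sum>k\<in>UNIV. v $ k *\<^sub>R axis k 1) = v"
        using basis_expansion[of v] by (simp add: scalar_mult_eq_scaleR)
      have "(\<Sum>k\<in>UNIV. v $ k * B (axis k 1) w) = B (\<Sum>k\<in>UNIV. v $ k *\<^sub>R axis k 1) w"
        "(\<Sum>k\<in>UNIV. v $ k * B w (axis k 1)) = B w (\<Sum>k\<in>UNIV. v $ k *\<^sub>R axis k 1)"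
        by (simp_all add: sum_left sum_right scaleR_left scaleR_right)
      then show "(\<Sum>k\<in>UNIV. v $ k * B (axis k 1) w) = B v w"
        and "(\<Sum>k\<in>UNIV. v $ k * B w (axis k 1)) = B w v"
        unfolding v .
    qed
    ultimately show ?case
      using rec[of 0 i j y] infinitesimal[of i y j] unfolding W_0 by simp
  next
    case (Suc n)
    \<comment> \<open>The recursion is homogeneous in \<open>W\<close>, so zero propagates.\<close>
    have "W (Suc n) i j = (\<lambda>_. 0)" for i j using Suc by blast
    then show ?case using rec[of "Suc n" i j y] by (simp add: lie_def del: of_nat_Suc)
  qed
  then show ?thesis using \<open>n \<noteq> 0\<close> unfolding W_def by (cases n) blast+
qed

text \<open>Along a solution, the time derivative of a function is its Lie derivative along
  \<open>f\<close>. Hence \<open>n\<close> time derivatives of the flow yield the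
  \<open>n\<close>-th iterate applied to the identity map.\<close>

lemma flow_coeff_lie:
  assumes f: "smooth f" and flow: "local_flow f \<phi>"
  shows "flow_coeff \<phi> n y = (1 / fact n) *\<^sub>R (lie f ^^ n) (\<lambda>y. y) y"
    and "smooth ((lie f ^^ n) (\<lambda>y. y))"
proof -
  have id: "smooth (\<lambda>y :: real ^ 'a. y)"
    by (rule smoothI) (simp_all add: smooth_const)
  have sm: "smooth ((lie f ^^ n) (\<lambda>y. y))" for n
    by (induction n) (simp_all add: id smooth_lie[OF f])
  then show "smooth ((lie f ^^ n) (\<lambda>y. y))" .
  obtain \<epsilon> where \<epsilon>: "\<epsilon> > 0" and
    ode: "\<And>t. t \<in> {-\<epsilon><..<\<epsilon>} \<Longrightarrow> ((\<lambda>s. \<phi> s y) has_vector_derivative f (\<phi> t y)) (at t)"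
    using flow unfolding local_flow_def by blast
  \<comment> \<open>The identity is proved on the whole open interval, since differentiating once
    more requires it near \<open>t\<close> and not just at 0.\<close>
  have "((\<lambda>x t. vector_derivative x (at t)) ^^ n) (\<lambda>t. \<phi> t y) t = (lie f ^^ n) (\<lambda>y. y) (\<phi> t y)"
    if "t \<in> {-\<epsilon><..<\<epsilon>}" for t
    using that
  proof (induction n arbitrary: t)
    case (Suc n)
    have "((\<lambda>t. (lie f ^^ n) (\<lambda>y. y) (\<phi> t y)) has_vector_derivative (lie f ^^ Suc n) (\<lambda>y. y) (\<phi> t y)) (at t)"
      using smooth_chain[OF sm ode[OF Suc.prems]] by (simp add: lie_def del: partials.simps)
    then have "(((\<lambda>x t. vector_derivative x (at t)) ^^ n) (\<lambda>t. \<phi> t y) has_vector_derivative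
        (lie f ^^ Suc n) (\<lambda>y. y) (\<phi> t y)) (at t)"
      by (rule has_vector_derivative_transform_within_open[OF _ _ Suc.prems]) (auto simp: Suc.IH)
    then show ?case by (simp add: vector_derivative_at)
  qed simp
  from this[of 0] show "flow_coeff \<phi> n y = (1 / fact n) *\<^sub>R (lie f ^^ n) (\<lambda>y. y) y"
    using flow \<epsilon> by (simp add: flow_coeff_def local_flow_def)
qed

section \<open>Symplectic linear algebra and Hamiltonian fields\<close>

lemma J_mat_square: "J_mat ** J_mat = (- mat 1 :: real ^ ('d::finite + 'd) ^ ('d + 'd))"
proof -
  have "(\<Sum>k\<in>UNIV. g k) = (\<Sum>k\<in>UNIV. g (Inl k)) + (\<Sum>k\<in>UNIV. g (Inr k))" for g :: "'d + 'd \<Rightarrow> real"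
    using sum.Plus[of UNIV UNIV g] by simp
  then have "(\<Sum>k\<in>UNIV. J_mat $ a $ k * J_mat $ k $ b) = (- mat 1 :: real ^ ('d + 'd) ^ ('d + 'd)) $ a $ b" for a b
    by (cases a; cases b) (simp_all add: J_mat_def mat_def if_distrib[of "\<lambda>c. c * _"] cong: if_cong)
  then show ?thesis by (simp add: vec_eq_iff matrix_matrix_mult_def)
qed

lemma transpose_J_mat: "transpose J_mat = (- J_mat :: real ^ ('d::finite + 'd) ^ ('d + 'd))"
  by (auto simp: vec_eq_iff transpose_def J_mat_def split: sum.split)

text \<open>As \<open>J_mat\<close> squares to minus the identity, \<open>- J_mat\<close> is a
  two-sided inverse; this existence justifies the choice in \<open>matrix_inv\<close>.\<close>

lemma J_mat_inv:
  fixes x :: "real ^ ('d::finite + 'd)"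
  shows "J_mat *v (matrix_inv J_mat *v x) = x" "matrix_inv J_mat *v (J_mat *v x) = x"
proof -
  have "A ** (- B) = - (A ** B)" "(- A) ** B = - (A ** B)" for A B :: "real ^ ('d + 'd) ^ ('d + 'd)"
    by (simp_all add: vec_eq_iff matrix_matrix_mult_def sum_negf)
  then have "J_mat ** (- J_mat) = (mat 1 :: real ^ ('d + 'd) ^ ('d + 'd))"
    "(- J_mat) ** J_mat = (mat 1 :: real ^ ('d + 'd) ^ ('d + 'd))"
    by (simp_all only: J_mat_square minus_minus)
  then have "invertible (J_mat :: real ^ ('d + 'd) ^ ('d + 'd))"
    unfolding invertible_def by blast
  then have "J_mat ** matrix_inv J_mat = (mat 1 :: real ^ ('d + 'd) ^ ('d + 'd)) \<and>
      matrix_inv J_mat ** J_mat = (mat 1 :: real ^ ('d + 'd) ^ ('d + 'd))"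
    unfolding matrix_inv_def invertible_def by (rule someI_ex)
  then show "J_mat *v (matrix_inv J_mat *v x) = x" "matrix_inv J_mat *v (J_mat *v x) = x"
    by (simp_all add: matrix_vector_mul_assoc)
qed

text \<open>The standard symplectic form. It turns the matrix condition for symplectic maps into
  invariance of a scalar bilinear form, to which the Cauchy product and the Lie series lemma
  apply.\<close>

definition sympl :: "real ^ ('d::finite + 'd) \<Rightarrow> real ^ ('d + 'd) \<Rightarrow> real" where
  "sympl u v = u \<bullet> (J_mat *v v)"

lemma bounded_bilinear_sympl: "bounded_bilinear sympl"
  unfolding sympl_def
  by (intro bounded_bilinear.comp[OF bounded_bilinear_inner] bounded_linear_ident matrix_vector_mul_bounded_linear)

lemma sympl_skew: "sympl u v = - sympl v u"
proof -
  have "u \<bullet> (J_mat *v v) = (transpose J_mat *v u) \<bullet> v"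
    by (simp add: dot_lmul_matrix)
  moreover have "- J_mat *v u = - (J_mat *v u)"
    by (simp add: vec_eq_iff matrix_vector_mult_def sum_negf)
  ultimately show ?thesis by (simp add: sympl_def transpose_J_mat inner_commute)
qed

lemma sympl_matrix:
  assumes "transpose A ** J_mat ** A = J_mat"
  shows "sympl (A *v u) (A *v v) = sympl u v"
proof -
  have "sympl (A *v u) (A *v v) = u \<bullet> (transpose A *v (J_mat *v (A *v v)))"
    using dot_lmul_matrix[of "J_mat *v (A *v v)" A u] by (simp add: sympl_def inner_commute)
  also have "\<dots> = sympl u v"
    using assms by (simp only: sympl_def matrix_vector_mul_assoc matrix_mul_assoc)
  finally show ?thesis .
qed

section \<open>Jacobians, gradients and Hamiltonian vector fields\<close>

lemma bounded_linear_matrix_vector_mult_left: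
  "bounded_linear (\<lambda>A :: real ^ 'n ^ 'm. A *v x)"
  by (simp add: linear_conv_bounded_linear[symmetric] linear_iff matrix_vector_mult_add_rdistrib
      scaleR_matrix_vector_assoc)

lemma jacobian_column:
  fixes g :: "real ^ 'n::finite \<Rightarrow> real ^ 'm"
  assumes "g differentiable (at y)"
  shows "jacobian g (at y) *v axis i 1 = partials [i] g y"
  using partial_eqI[OF assms[unfolded jacobian_works]] by simp

lemma grad_nth: "grad K y $ i = partials [i] K y"
  by (simp add: grad_def)

lemma smooth_grad: "smooth K \<Longrightarrow> smooth (grad K)"
proof -
  assume K: "smooth K"
  have "grad K = (\<lambda>y. \<Sum>i\<in>UNIV. partials [i] K y *\<^sub>R axis i 1)"
  proof
    show "grad K y = (\<Sum>i\<in>UNIV. partials [i] K y *\<^sub>R axis i 1)" for y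
      using basis_expansion[of "grad K y"]
      by (simp add: grad_nth scalar_mult_eq_scaleR del: partials.simps)
  qed
  then show ?thesis
    by (simp only:) (intro smooth_sum smooth_bounded_linear[OF bounded_linear_scaleR_left] smooth_partials K)
qed

lemma smooth_ham_field: "smooth K \<Longrightarrow> smooth (ham_field K)"
  unfolding ham_field_def[abs_def]
  by (intro smooth_bounded_linear[OF matrix_vector_mul_bounded_linear] smooth_grad)

text \<open>This makes a truncated series of Hamiltonian fields, at a fixed step size, the field of
  one single Hamiltonian.\<close>

lemma ham_field_sum:
  assumes "\<And>k. k \<in> A \<Longrightarrow> smooth (K k)"
  shows "ham_field (\<lambda>z. \<Sum>k\<in>A. a k *\<^sub>R K k z) y = (\<Sum>k\<in>A. a k *\<^sub>R ham_field (K k) y)"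
proof -
  have "partials [i] (\<lambda>z. \<Sum>k\<in>A. a k *\<^sub>R K k z) y = (\<Sum>k\<in>A. a k *\<^sub>R partials [i] (K k) y)" for i
    by (subst partials_sum)
      (intro smooth_bounded_linear[OF bounded_linear_scaleR_right] assms sum.cong refl
        partial_bounded_linear[OF bounded_linear_scaleR_right] smooth_differentiable | assumption)+
  then have "grad (\<lambda>z. \<Sum>k\<in>A. a k *\<^sub>R K k z) y = (\<Sum>k\<in>A. a k *\<^sub>R grad (K k) y)"
    by (simp add: vec_eq_iff grad_nth del: partials.simps)
  then show ?thesis
    by (simp add: ham_field_def linear_sum[OF matrix_vector_mul_linear] linear_cmul[OF matrix_vector_mul_linear])
qed

lemma sympl_partial_nth:
  assumes "X differentiable (at y)"
  shows "sympl (axis j 1) (partials [i] X y) = partials [i] (\<lambda>z. J_mat *v X z) y $ j"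
  unfolding sympl_def partial_bounded_linear[OF matrix_vector_mul_bounded_linear assms]
  by (simp add: inner_axis' del: partials.simps)

text \<open>Multiplying the field by \<open>J_mat\<close> gives \<open>grad K\<close>, whose
  Jacobian is the Hessian. Its symmetry, with the sign from \<open>sympl_skew\<close>, is the
  claim.\<close>

lemma ham_field_infinitesimal:
  assumes K: "smooth K"
  shows "sympl (partials [i] (ham_field K) y) (axis j 1) + sympl (axis i 1) (partials [j] (ham_field K) y) = 0"
proof -
  have *: "sympl (axis j 1) (partials [i] (ham_field K) y) = partials [i] (partials [j] K) y" for i j
  proof -
    have "(\<lambda>z. J_mat *v ham_field K z) = grad K"
      by (simp add: fun_eq_iff ham_field_def J_mat_inv)
    moreover have "partials [i] (grad K) y $ j = partials [i] (partials [j] K) y"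
      using partial_nth[OF smooth_differentiable[OF smooth_grad[OF K]], of i j y] unfolding grad_nth by simp
    ultimately show ?thesis
      unfolding sympl_partial_nth[OF smooth_differentiable[OF smooth_ham_field[OF K]]] by simp
  qed
  show ?thesis
    unfolding sympl_skew[of "partials [i] (ham_field K) y"] * using partials_commute[OF K, of i j] by simp
qed

text \<open>By skewness of the form, \<open>inf\<close> says that \<open>J_mat *v X y\<close> has a
  symmetric Jacobian. Its potential is the Hamiltonian sought.\<close>

lemma infinitesimally_symplectic_imp_ham_field:
  assumes X: "smooth X"
    and inf: "\<And>i j y. sympl (partials [i] X y) (axis j 1) + sympl (axis i 1) (partials [j] X y) = 0"
  shows "\<exists>K. smooth K \<and> (\<forall>y. X y = ham_field K y)"
proof -
  have JX: "smooth (\<lambda>y. J_mat *v X y)"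
    by (intro smooth_bounded_linear[OF matrix_vector_mul_bounded_linear] X)
  have "partials [i] (\<lambda>y. J_mat *v X y) y $ j = partials [j] (\<lambda>y. J_mat *v X y) y $ i" for i j y
    using inf[of i y j] sympl_skew[of "partials [i] X y" "axis j 1"]
    unfolding sympl_partial_nth[OF smooth_differentiable[OF X], symmetric] by simp
  from gradient_potential[OF JX this] obtain K where K: "smooth K" "\<And>y. grad K y = J_mat *v X y"
    by blast
  then have "X y = ham_field K y" for y by (simp add: ham_field_def J_mat_inv)
  with K show ?thesis by blast
qed

section \<open>Symplecticity of the expansion coefficients\<close>

text \<open>For all small positive \<open>h\<close> the numerical map preserves the form, so the
  form on the transported vectors is constant in \<open>h\<close>. Its expansion is a Cauchy
  product, whose coefficients of positive order must vanish.\<close>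

lemma symplectic_step_coeff:
  assumes int: "integrator D \<Phi> d" and sympl: "symplectic_integrator D \<Phi>"
    and K: "\<And>k. k \<in> {1..r} \<Longrightarrow> smooth (K k)" "\<And>k y. k \<in> {1..r} \<Longrightarrow> G k y = ham_field (K k) y"
    and G: "\<And>k. k \<ge> 1 \<Longrightarrow> smooth (G k)" "\<And>k. k > r \<Longrightarrow> G k = (\<lambda>_. 0)" and "n \<noteq> 0"
  defines "A \<equiv> \<lambda>n y. jacobian (step_coeff d G n) (at y)"
  shows "(\<Sum>a\<le>n. sympl (A a y *v u) (A (n - a) y *v v)) = 0"
proof -
  define g where "g h z = (\<Sum>k = 1..r. h ^ (k - 1) *\<^sub>R G k z)" for h z
  have eventually: "\<forall>\<^sub>F h in at_right 0. y \<in> D h (g h)"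
    and "expands (\<lambda>h. jacobian (\<Phi> h (g h)) (at y)) (\<lambda>n. A n y)"
    using int G unfolding integrator_def A_def g_def Let_def by (auto simp: eventually_conj_iff)
  then have "expands (\<lambda>h. sympl (jacobian (\<Phi> h (g h)) (at y) *v u) (jacobian (\<Phi> h (g h)) (at y) *v v))
      (\<lambda>n. \<Sum>a\<le>n. sympl (A a y *v u) (A (n - a) y *v v))"
    by (intro expands_bilinear[OF bounded_bilinear_sympl]
        expands_bounded_linear[OF bounded_linear_matrix_vector_mult_left])
  moreover have "\<forall>\<^sub>F h in at_right 0.
      sympl (jacobian (\<Phi> h (g h)) (at y) *v u) (jacobian (\<Phi> h (g h)) (at y) *v v) = sympl u v"
    using eventually eventually_at_right_less[of 0]
  proof eventually_elim
    case (elim h)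
    \<comment> \<open>With \<open>h\<close> fixed, the powers of \<open>h\<close> are mere scalars
      and are absorbed into one Hamiltonian.\<close>
    have "g h = ham_field (\<lambda>z. \<Sum>k = 1..r. h ^ (k - 1) *\<^sub>R K k z)"
      by (rule ext, subst ham_field_sum) (simp_all add: K g_def)
    moreover have "smooth (\<lambda>z. \<Sum>k = 1..r. h ^ (k - 1) *\<^sub>R K k z)"
      by (intro smooth_sum smooth_bounded_linear[OF bounded_linear_scaleR_right] K)
    ultimately have "symplectic_on (D h (g h)) (\<Phi> h (g h))"
      using sympl elim unfolding symplectic_integrator_def by auto
    then show ?case using elim by (intro sympl_matrix) (simp add: symplectic_on_def)
  qed
  ultimately show ?thesis using \<open>n \<noteq> 0\<close> by (rule expands_const_unique)
qed

text \<open>The factorials turn iteration of the Lie derivative into the recursion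
  \<open>(n + 1) c (n + 1) = lie f (c n)\<close>, so \<open>lie_series_preserves_bilinear\<close>
  applies to the symplectic form.\<close>

lemma symplectic_flow_coeff:
  assumes K: "smooth K" and flow: "local_flow (ham_field K) \<phi>"
  shows "smooth (flow_coeff \<phi> n)" "flow_coeff \<phi> 0 = (\<lambda>y. y)"
    and "n \<noteq> 0 \<Longrightarrow> (\<Sum>a\<le>n. sympl (partials [i] (flow_coeff \<phi> a) y) (partials [j] (flow_coeff \<phi> (n - a)) y)) = 0"
proof -
  let ?f = "ham_field K"
  note f = smooth_ham_field[OF K]
  note coeff = flow_coeff_lie[OF f flow]
  have coeff_eq: "flow_coeff \<phi> n = (\<lambda>y. (1 / fact n) *\<^sub>R (lie ?f ^^ n) (\<lambda>y. y) y)" for n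
    using coeff(1) by blast
  show sm: "smooth (flow_coeff \<phi> n)" for n
    unfolding coeff_eq by (intro smooth_bounded_linear[OF bounded_linear_scaleR_right] coeff(2))
  show c0: "flow_coeff \<phi> 0 = (\<lambda>y. y)"
    by (simp add: coeff_eq)
  have "(\<lambda>y. real (Suc n) *\<^sub>R flow_coeff \<phi> (Suc n) y) = lie ?f (flow_coeff \<phi> n)" for n
    unfolding coeff_eq lie_def
    by (simp add: partial_bounded_linear[OF bounded_linear_scaleR_right smooth_differentiable[OF coeff(2)], unfolded lie_def]
        scaleR_sum_right fun_eq_iff mult.commute del: partials.simps)
  from lie_series_preserves_bilinear[OF bounded_bilinear_sympl f sm c0 this ham_field_infinitesimal[OF K]]
  show "n \<noteq> 0 \<Longrightarrow> (\<Sum>a\<le>n. sympl (partials [i] (flow_coeff \<phi> a) y) (partials [j] (flow_coeff \<phi> (n - a)) y)) = 0" .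
qed

section \<open>Induction on the coefficients of the inverse modified equation\<close>

theorem theorem2:
  fixes D :: "real \<Rightarrow> (real ^ ('d::finite + 'd) \<Rightarrow> real ^ ('d + 'd)) \<Rightarrow> (real ^ ('d + 'd)) set"
    and \<Phi> :: "real \<Rightarrow> (real ^ ('d + 'd) \<Rightarrow> real ^ ('d + 'd)) \<Rightarrow>
                 real ^ ('d + 'd) \<Rightarrow> real ^ ('d + 'd)"
    and d :: "nat \<Rightarrow> 'd + 'd \<Rightarrow> ('d + 'd) dpoly"
    and H :: "real ^ ('d + 'd) \<Rightarrow> real"
    and \<phi> :: "real \<Rightarrow> real ^ ('d + 'd) \<Rightarrow> real ^ ('d + 'd)"
    and F :: "nat \<Rightarrow> real ^ ('d + 'd) \<Rightarrow> real ^ ('d + 'd)"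
  assumes "integrator D \<Phi> d"
    and "symplectic_integrator D \<Phi>"
    and "order_at_least_1 d"
    and "smooth H"
    and "local_flow (ham_field H) \<phi>"
    and "inverse_modified d \<phi> F"
  shows "\<exists>Hs :: nat \<Rightarrow> real ^ ('d + 'd) \<Rightarrow> real.
           \<forall>j\<ge>1. smooth (Hs j) \<and> (\<forall>y. F j y = ham_field (Hs j) y)"
proof -
  have F: "smooth (F j)" if "j \<ge> 1" for j
    using assms(6) that by (simp add: inverse_modified_def)
  have step_F: "step_coeff d F n = flow_coeff \<phi> n" for n
    using assms(6) by (simp add: inverse_modified_def fun_eq_iff)
  note c = symplectic_flow_coeff[OF assms(4,5)]
  interpret sympl: bounded_bilinear "sympl :: real ^ ('d + 'd) \<Rightarrow> _" by (rule bounded_bilinear_sympl)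
  have "\<exists>K. smooth K \<and> (\<forall>y. F j y = ham_field K y)" if "j \<ge> 1" for j
    using that
  proof (induction j rule: less_induct)
    case (less j)
    \<comment> \<open>The case \<open>j = 1\<close> needs no separate treatment: then
      \<open>r = 0\<close> and the truncated field is zero.\<close>
    then obtain r where j: "j = Suc r" by (cases j) auto
    have "\<forall>k\<in>{1..r}. \<exists>K. smooth K \<and> (\<forall>y. F k y = ham_field K y)"
      using less j by auto
    then obtain K where K: "\<And>k. k \<in> {1..r} \<Longrightarrow> smooth (K k)"
      "\<And>k y. k \<in> {1..r} \<Longrightarrow> F k y = ham_field (K k) y" by metis
    \<comment> \<open>Cutting \<open>F\<close> off after index \<open>r\<close> leaves a polynomial
      in \<open>h\<close> with Hamiltonian coefficients, to which symplecticity of the integrator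
      applies.\<close>
    define G where "G k = (if k \<le> r then F k else (\<lambda>_. 0))" for k
    have G: "smooth (G k)" if "k \<ge> 1" for k
      using F[OF that] by (simp add: G_def smooth_const)
    have step_G: "step_coeff d G n = flow_coeff \<phi> n" if "n \<le> r" for n
      unfolding step_F[symmetric] using that by (intro step_coeff_cong) (simp add: G_def)
    have step_G_Suc: "step_coeff d G j = (\<lambda>y. flow_coeff \<phi> j y - F j y)"
    proof
      fix y
      \<comment> \<open>Since \<open>j = Suc r\<close> lies just beyond the cut, \<open>G j\<close>
        is zero and the two expansions differ by \<open>F j\<close> itself.\<close>
      have "step_coeff d F j y - step_coeff d G j y = F j y - G j y"
        unfolding j by (intro step_coeff_Suc_diff assms(3) F G) (simp_all add: G_def)
      then show "step_coeff d G j y = flow_coeff \<phi> j y - F j y"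
        by (simp add: step_F G_def j algebra_simps)
    qed
    have "sympl (partials [i] (F j) y) (axis l 1) + sympl (axis i 1) (partials [l] (F j) y) = 0" for i l y
    proof -
      define C where "C i a = partials [i] (flow_coeff \<phi> a) y" for i a
      define X where "X i = partials [i] (F j) y" for i
      have C0: "C i 0 = axis i 1" for i by (simp add: C_def c(2))
      have A: "jacobian (step_coeff d G a) (at y) *v axis i 1 = C i a - (if a = j then X i else 0)"
        if "a \<le> j" for a i
      proof (cases "a = j")
        case True
        have "partials [i] (\<lambda>y. flow_coeff \<phi> j y - F j y) y = C i j - X i"
          using partial_eqI[OF has_derivative_diff[OF c(1)[THEN smooth_has_derivative]
                F[THEN smooth_has_derivative, OF less.prems]]]
          by (simp add: C_def X_def axis_def if_distrib[of "\<lambda>c. c *\<^sub>R _"] cong: if_cong del: partials.simps)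
        then show ?thesis
          using True c(1) F[OF less.prems]
          by (simp add: step_G_Suc jacobian_column smooth_differentiable del: partials.simps)
      next
        case False
        then show ?thesis
          using that c(1)
          by (simp add: j step_G jacobian_column smooth_differentiable C_def del: partials.simps)
      qed
      have "0 = (\<Sum>a\<le>j. sympl (jacobian (step_coeff d G a) (at y) *v axis i 1)
          (jacobian (step_coeff d G (j - a)) (at y) *v axis l 1))"
        using symplectic_step_coeff[OF assms(1,2), of r K G j] K G j by (simp add: G_def)
      \<comment> \<open>The correction \<open>X\<close> occurs only at index \<open>j\<close>, that
        is, in the left factor for \<open>a = j\<close> and in the right factor for
        \<open>a = 0\<close>. These differ as \<open>j\<close> is positive, so no term is quadratic
        in \<open>X\<close>.\<close>
      also have "\<dots> = (\<Sum>a\<le>j. sympl (C i a) (C l (j - a)) -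
          (if a = j then sympl (X i) (C l 0) else 0) - (if a = 0 then sympl (C i 0) (X l) else 0))"
        using less.prems by (intro sum.cong refl) (auto simp: A sympl.diff_left sympl.diff_right sympl.zero_left sympl.zero_right)
      \<comment> \<open>The flow part of the sum vanishes because the exact flow is symplectic, and
        the partner of \<open>X\<close> is a basis vector since the coefficient of order 0 is the
        identity map.\<close>
      also have "\<dots> = - sympl (X i) (axis l 1) - sympl (axis i 1) (X l)"
        using c(3)[of j i y l] less.prems
        by (simp add: sum_subtractf C_def[symmetric] C0 del: partials.simps)
      finally show ?thesis by (simp add: X_def)
    qed
    then show ?case
      by (intro infinitesimally_symplectic_imp_ham_field F less.prems)
  qed
  then show ?thesis by metis
qed

end
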